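(* Let $s\ge 0$ and $n \geq 2s+1$ be integers. Then $$T_{n+1}^{(s)}(x)=\sum_{i=0}^s\left(x^{i+2}T_{n-2i}^{(s-i)}(x)+x^iT_{n-2i-2}^{(s-i-1)}(x)\right).$$
   Context: For integers $m\ge 0$ and $0\le s\le \lfloor m/2\rfloor$, the incomplete tribonacci polynomial is defined by $$T_{m+1}^{(s)}(x)=\sum_{i=0}^{s}\sum_{j=0}^i \binom{i}{j}\binom{m-i-j}{i}x^{2m-3(i+j)}.$$ By convention, $T_m^{(-1)}(x)=0$ for every integer $m$. *)

theory Defs
  imports "HOL-Computational_Algebra.Polynomial"
begin

text \<open>
  \<open>incomplete_tribonacci k s\<close> is the polynomial $T_k^{(s)}$, so that $k = m + 1$ in the
  defining formula. It is meaningful for $0 \le s \le \lfloor (k-1)/2 \rfloor$ and, by convention,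
  for $s = -1$ with any integer $k$; other arguments give irrelevant values.
  In the meaningful range $i + j \le m$, so \<open>m - i - j\<close> does not truncate, and the exponent
  \<open>2 * m - 3 * (i + j)\<close> truncates only where the second binomial coefficient vanishes
  (a nonzero coefficient forces $2i + j \le m$, hence $3(i+j) \le 4i + 2j \le 2m$).
\<close>

definition incomplete_tribonacci :: "int \<Rightarrow> int \<Rightarrow> int poly" where
  "incomplete_tribonacci k s =
    (if s < 0 then 0
     else (let m = nat (k - 1) in
       \<Sum>i=0..nat s. \<Sum>j=0..i.
         monom (int (i choose j) * int ((m - i - j) choose i)) (2 * m - 3 * (i + j))))"

end

theory Submission
  imports Defs
begin

text \<open>
  The identity is an unrolled three-term recurrence. In the range \<open>n \<ge> 2 * s + 1\<close> the
  incomplete tribonacci polynomials satisfy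
  \[ T_{n+1}^{(s)} = x^2\, T_n^{(s)} + x\, T_{n-1}^{(s-1)} + T_{n-2}^{(s-1)} \]
  (lemma \<open>incomplete_tribonacci_recurrence\<close>). The two outer terms on the right are the summand
  \<open>i = 0\<close> of the claim. The middle one is $x$ times a polynomial of the same kind, with
  \<open>n - 2\<close> and \<open>s - 1\<close> in place of \<open>n\<close> and \<open>s\<close>. The range condition is invariant under this
  step, so applying the recurrence to the middle term again and again produces the summands
  \<open>i = 1, \<dots>, s\<close>, each step contributing one more factor $x$; after step \<open>s\<close> the middle term is
  zero by the convention $T^{(-1)} = 0$.

  The recurrence itself already holds summand by summand in the defining double sum (lemma
  \<open>trib_term_recurrence\<close>): Pascal's rule for $\binom{m-i-j}{i}$ splits off the first term on the
  right, and Pascal's rule for $\binom{i}{j}$ splits the rest into the other two.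
\<close>

section \<open>Summands of the defining double sum\<close>

definition trib_term :: "nat \<Rightarrow> nat \<Rightarrow> nat \<Rightarrow> int poly" where
  "trib_term m i j =
    monom (int (i choose j) * int ((m - i - j) choose i)) (2 * m - 3 * (i + j))"

definition trib_row :: "nat \<Rightarrow> nat \<Rightarrow> int poly" where
  "trib_row m i = (\<Sum>j=0..i. trib_term m i j)"

lemma incomplete_tribonacci_eq_sum_trib_row:
  "incomplete_tribonacci (int m + 1) (int s) = (\<Sum>i=0..s. trib_row m i)"
  by (simp add: incomplete_tribonacci_def trib_row_def trib_term_def)

text \<open>
  A power of $x$ may be moved inside the truncated subtraction in the exponent: a nonzero
  coefficient forces \<open>j \<le> i\<close> and \<open>2 * i + j \<le> m\<close>, hence
  \<open>3 * (i + j) \<le> 4 * i + 2 * j \<le> 2 * m\<close>.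
\<close>

lemma monom_mult_trib_term:
  "monom 1 d * trib_term m i j =
    monom (int (i choose j) * int ((m - i - j) choose i)) (d + 2 * m - 3 * (i + j))"
proof (cases "j \<le> i \<and> i \<le> m - i - j")
  case True
  then have "3 * (i + j) \<le> 2 * m"
    by (cases "i = 0") auto
  then show ?thesis
    by (simp add: trib_term_def mult_monom)
next
  case False
  then have "int (i choose j) * int ((m - i - j) choose i) = 0"
    by (auto simp: not_le)
  then show ?thesis
    by (simp only: trib_term_def mult_monom mult_1_left monom_eq_0)
qed

text \<open>
  With \<open>N = m - i - j\<close>, the coefficient on the left is
  \<open>(Suc i choose Suc j) * (Suc N choose Suc i)\<close>, and the three coefficients on the right are
  what Pascal's rule, applied first to the second factor, makes of it. The hypothesis ensures
  that \<open>N\<close> is a true difference; the powers of $x$ bring all exponents to \<open>2 * m - 3 * (i + j)\<close>.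
\<close>

lemma trib_term_recurrence:
  assumes "i + j \<le> m"
  shows "trib_term (m + 3) (Suc i) (Suc j) =
    monom 1 2 * trib_term (m + 2) (Suc i) (Suc j)
    + monom 1 1 * trib_term (m + 1) i (Suc j) + trib_term m i j"
proof -
  have "m + 3 - Suc i - Suc j = Suc (m - i - j)" "m + 2 - Suc i - Suc j = m - i - j"
    "m + 1 - i - Suc j = m - i - j"
    using assms by auto
  then show ?thesis
    unfolding monom_mult_trib_term
    by (simp add: trib_term_def add_monom algebra_simps)
qed

lemma trib_term_recurrence_0:
  assumes "i \<le> m + 1"
  shows "trib_term (m + 3) (Suc i) 0 =
    monom 1 2 * trib_term (m + 2) (Suc i) 0 + monom 1 1 * trib_term (m + 1) i 0"
proof -
  have "m + 3 - Suc i - 0 = Suc (m + 1 - i)" "m + 2 - Suc i - 0 = m + 1 - i"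
    "2 * (m + 3) - 3 * (Suc i + 0) = 2 * m + 3 - 3 * i"
    "2 + 2 * (m + 2) - 3 * (Suc i + 0) = 2 * m + 3 - 3 * i"
    "1 + 2 * (m + 1) - 3 * (i + 0) = 2 * m + 3 - 3 * i"
    using assms by auto
  then show ?thesis
    unfolding monom_mult_trib_term unfolding trib_term_def
    by (simp only: add_monom diff_zero binomial_n_0 binomial_Suc_Suc of_nat_add of_nat_1
        mult_1_left add.commute)
qed

section \<open>The three-term recurrence\<close>

lemma trib_row_0: "trib_row (Suc m) 0 = monom 1 2 * trib_row m 0"
  by (simp add: trib_row_def trib_term_def mult_monom)

lemma trib_row_recurrence:
  assumes "2 * i \<le> m"
  shows "trib_row (m + 3) (Suc i) =
    monom 1 2 * trib_row (m + 2) (Suc i) + monom 1 1 * trib_row (m + 1) i + trib_row m i"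
proof -
  \<comment> \<open>Row \<open>i\<close> may be extended to \<open>j = Suc i\<close>, where \<open>i choose j\<close> vanishes, so that it can be
    matched with row \<open>Suc i\<close>.\<close>
  have row: "trib_row (m + 1) i = trib_term (m + 1) i 0 + (\<Sum>j=0..i. trib_term (m + 1) i (Suc j))"
  proof -
    have "trib_row (m + 1) i = (\<Sum>j=0..Suc i. trib_term (m + 1) i j)"
      by (simp add: trib_row_def trib_term_def)
    then show ?thesis
      by (simp only: sum.atLeast0_atMost_Suc_shift o_def)
  qed
  have row_Suc: "trib_row k (Suc i) = trib_term k (Suc i) 0 + (\<Sum>j=0..i. trib_term k (Suc i) (Suc j))"
    for k
    by (simp only: trib_row_def sum.atLeast0_atMost_Suc_shift o_def)
  have "(\<Sum>j=0..i. trib_term (m + 3) (Suc i) (Suc j)) =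
    (\<Sum>j=0..i. monom 1 2 * trib_term (m + 2) (Suc i) (Suc j)
      + monom 1 1 * trib_term (m + 1) i (Suc j) + trib_term m i j)"
    using assms by (intro sum.cong refl trib_term_recurrence) auto
  moreover have "trib_term (m + 3) (Suc i) 0 =
    monom 1 2 * trib_term (m + 2) (Suc i) 0 + monom 1 1 * trib_term (m + 1) i 0"
    using assms by (intro trib_term_recurrence_0) auto
  ultimately show ?thesis
    unfolding row row_Suc trib_row_def[of m]
    by (simp add: sum.distrib sum_distrib_left algebra_simps)
qed

lemma incomplete_tribonacci_recurrence:
  fixes s n :: nat
  assumes "n \<ge> 2 * s + 1"
  shows "incomplete_tribonacci (int n + 1) (int s) =
    monom 1 2 * incomplete_tribonacci (int n) (int s)
    + monom 1 1 * incomplete_tribonacci (int n - 1) (int s - 1)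
    + incomplete_tribonacci (int n - 2) (int s - 1)"
proof (cases s)
  case 0
  obtain m where "n = Suc m"
    using assms by (cases n) auto
  then show ?thesis
    using 0 incomplete_tribonacci_eq_sum_trib_row[of n 0]
      incomplete_tribonacci_eq_sum_trib_row[of m 0]
    by (simp add: trib_row_0 incomplete_tribonacci_def[of _ "-1"] add.commute)
next
  case (Suc r)
  define m where "m = n - 3"
  have n: "n = m + 3" and m: "2 * r \<le> m"
    using assms Suc by (auto simp: m_def)
  have T:
    "incomplete_tribonacci (int n + 1) (int s) = (\<Sum>i=0..s. trib_row (m + 3) i)"
    "incomplete_tribonacci (int n) (int s) = (\<Sum>i=0..s. trib_row (m + 2) i)"
    "incomplete_tribonacci (int n - 1) (int s - 1) = (\<Sum>i=0..r. trib_row (m + 1) i)"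
    "incomplete_tribonacci (int n - 2) (int s - 1) = (\<Sum>i=0..r. trib_row m i)"
    unfolding incomplete_tribonacci_eq_sum_trib_row[symmetric]
    using n Suc by (auto intro!: arg_cong2[where f = incomplete_tribonacci])
  have "(\<Sum>i=0..r. trib_row (m + 3) (Suc i)) =
    (\<Sum>i=0..r. monom 1 2 * trib_row (m + 2) (Suc i) + monom 1 1 * trib_row (m + 1) i + trib_row m i)"
    using m by (intro sum.cong refl trib_row_recurrence) auto
  moreover have "trib_row (m + 3) 0 = monom 1 2 * trib_row (m + 2) 0"
    using trib_row_0[of "m + 2"] by (simp add: eval_nat_numeral)
  ultimately have "(\<Sum>i=0..s. trib_row (m + 3) i) =
    monom 1 2 * (\<Sum>i=0..s. trib_row (m + 2) i)
    + monom 1 1 * (\<Sum>i=0..r. trib_row (m + 1) i) + (\<Sum>i=0..r. trib_row m i)"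
    unfolding Suc sum.atLeast0_atMost_Suc_shift o_def
    by (simp add: sum.distrib sum_distrib_left algebra_simps)
  then show ?thesis
    by (simp only: T)
qed

section \<open>Unrolling the recurrence\<close>

theorem mainTheorem4:
  fixes s n :: nat
  assumes "n \<ge> 2 * s + 1"
  shows "incomplete_tribonacci (int n + 1) (int s) =
    (\<Sum>i=0..s.
        monom 1 (i + 2) * incomplete_tribonacci (int n - 2 * int i) (int s - int i)
      + monom 1 i * incomplete_tribonacci (int n - 2 * int i - 2) (int s - int i - 1))"
  using assms
proof (induction s arbitrary: n)
  case 0
  then show ?case
    using incomplete_tribonacci_recurrence[of 0 n]
    by (simp add: incomplete_tribonacci_def[of _ "-1"] numeral_2_eq_2)
next
  case (Suc s)
  let ?f = "\<lambda>n s i. monom 1 (i + 2) * incomplete_tribonacci (int n - 2 * int i) (int s - int i)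
      + monom 1 i * incomplete_tribonacci (int n - 2 * int i - 2) (int s - int i - 1)"
  have n: "int (n - 2) = int n - 2"
    using Suc.prems by simp
  have shift: "monom 1 1 * ?f (n - 2) s i = ?f n (Suc s) (Suc i)" for i
    by (simp add: n distrib_left mult.assoc[symmetric] mult_monom algebra_simps)
  have "incomplete_tribonacci (int n - 1) (int (Suc s) - 1) = (\<Sum>i=0..s. ?f (n - 2) s i)"
    using Suc.IH[of "n - 2"] Suc.prems n by simp
  then have "monom 1 1 * incomplete_tribonacci (int n - 1) (int (Suc s) - 1) =
    (\<Sum>i=0..s. ?f n (Suc s) (Suc i))"
    by (simp only: sum_distrib_left shift)
  moreover have "?f n (Suc s) 0 =
    monom 1 2 * incomplete_tribonacci (int n) (int (Suc s))
    + incomplete_tribonacci (int n - 2) (int (Suc s) - 1)"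
    by (simp add: numeral_2_eq_2)
  ultimately show ?case
    unfolding sum.atLeast0_atMost_Suc_shift o_def
      incomplete_tribonacci_recurrence[OF Suc.prems]
    by (simp only: ac_simps)
qed

end
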